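(* Let $G$ be an abelian topological group. The operations of multiplication $(T,S)\mapsto TS$ and inversion $T\mapsto T^{-1}$ are continuous in $\mathsf{Hom}_{\mathsf{nb}}(G)$ with respect to the topology of uniform convergence on some neighborhood of $e_G$.
   Context: $e_G$ denotes the identity element of $G$. A subset $B$ of a topological group $G$ is bounded if for each neighborhood $U$ of $e_G$ there is a positive integer $n$ with $B\subset U^n$, where $U^n=\{u_1\cdots u_n:u_i\in U\}$. A (not necessarily continuous) group homomorphism $T:G\to G$ is $\mathsf{nb}$-bounded if there exists a neighborhood $U$ of $e_G$ such that $T(U)$ is bounded in $G$. $\mathsf{Hom}_{\mathsf{nb}}(G)$ is the set of all $\mathsf{nb}$-bounded homomorphisms $G\to G$. For homomorphisms $T,S$ on $G$, the operations are pointwise: $(TS)(x):=T(x)S(x)$ and $T^{-1}(x):=(T(x))^{-1}$ for $x\in G$. $\mathsf{Hom}_{\mathsf{nb}}(G)$ is equipped with the topology of uniform convergence on some neighborhood of $e_G$: a net $(S_\alpha)$ of $\mathsf{nb}$-bounded homomorphisms converges to $S$ if there is a neighborhood $U$ of $e_G$ on which it converges uniformly to $S$, i.e. such that for each neighborhood $V$ of $e_G$ there exists an $\alpha_0$ with $(S_\alpha S^{-1})(U)\subset V$ for each $\alpha\ge\alpha_0$. Continuity of the operations is understood with respect to this convergence of nets. *)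

theory Defs
  imports Complex_Main
begin

text \<open>
  The abelian topological group \<open>G\<close> is a type of class \<^class>\<open>topological_ab_group_add\<close>, written
  additively: \<open>e\<^sub>G\<close> is \<open>0\<close>, the product \<open>TS\<close> is the pointwise sum, and \<open>T\<^sup>-\<^sup>1\<close> the pointwise negation.
  No separation axiom is assumed.
\<close>

definition nbhd0 :: "'a::topological_ab_group_add set \<Rightarrow> bool" where
  "nbhd0 U \<longleftrightarrow> (\<exists>W. open W \<and> 0 \<in> W \<and> W \<subseteq> U)"

text \<open>\<open>U\<^sup>n\<close> in multiplicative notation; not the set of multiples \<open>n u\<close> of single elements of \<open>U\<close>.\<close>

definition nfold_sum :: "nat \<Rightarrow> 'a::topological_ab_group_add set \<Rightarrow> 'a set" where
  "nfold_sum n U = {(\<Sum>i<n. u i) | u. \<forall>i<n. u i \<in> U}"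

definition group_bounded :: "'a::topological_ab_group_add set \<Rightarrow> bool" where
  "group_bounded B \<longleftrightarrow> (\<forall>U. nbhd0 U \<longrightarrow> (\<exists>n>0. B \<subseteq> nfold_sum n U))"

definition Hom_nb :: "('a::topological_ab_group_add \<Rightarrow> 'a) set" where
  "Hom_nb = {T. additive T \<and> (\<exists>U. nbhd0 U \<and> group_bounded (T ` U))}"

definition directed_set :: "'i set \<Rightarrow> ('i \<Rightarrow> 'i \<Rightarrow> bool) \<Rightarrow> bool" where
  "directed_set D le \<longleftrightarrow> D \<noteq> {} \<and> reflp_on D le \<and> transp_on D le \<and>
     (\<forall>a\<in>D. \<forall>b\<in>D. \<exists>c\<in>D. le a c \<and> le b c)"

text \<open>
  Convergence in \<open>Hom_nb\<close> of the net \<open>(S \<alpha>)\<close> indexed by \<open>(D, le)\<close>. The neighbourhood \<open>U\<close> may depend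
  on the net but is chosen before \<open>V\<close>. Membership of the net and of the limit in \<^const>\<open>Hom_nb\<close> is
  part of the notion.
\<close>

definition nb_converges ::
    "'i set \<Rightarrow> ('i \<Rightarrow> 'i \<Rightarrow> bool) \<Rightarrow> ('i \<Rightarrow> 'a::topological_ab_group_add \<Rightarrow> 'a) \<Rightarrow> ('a \<Rightarrow> 'a) \<Rightarrow> bool" where
  "nb_converges D le S L \<longleftrightarrow> (\<forall>\<alpha>\<in>D. S \<alpha> \<in> Hom_nb) \<and> L \<in> Hom_nb \<and>
     (\<exists>U. nbhd0 U \<and> (\<forall>V. nbhd0 V \<longrightarrow>
        (\<exists>\<alpha>0\<in>D. \<forall>\<alpha>\<in>D. le \<alpha>0 \<alpha> \<longrightarrow> (\<lambda>x. S \<alpha> x - L x) ` U \<subseteq> V)))"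

definition hom_mult :: "('a::topological_ab_group_add \<Rightarrow> 'a) \<Rightarrow> ('a \<Rightarrow> 'a) \<Rightarrow> 'a \<Rightarrow> 'a" where
  "hom_mult T S = (\<lambda>x. T x + S x)"

definition hom_inv :: "('a::topological_ab_group_add \<Rightarrow> 'a) \<Rightarrow> 'a \<Rightarrow> 'a" where
  "hom_inv T = (\<lambda>x. - T x)"

end

theory Submission
  imports Defs
begin

text \<open>
  Two things have to be shown for each operation: it maps \<^const>\<open>Hom_nb\<close> to itself, and it respects
  uniform convergence on a neighbourhood of \<open>0\<close>.

  Closure rests on a concatenation of sums: if \<open>A\<close> is covered by the \<open>m\<close>-fold and \<open>B\<close> by the
  \<open>n\<close>-fold sums from \<open>V\<close>, then \<open>A + B\<close> is covered by the \<open>(m + n)\<close>-fold sums from the same \<open>V\<close>. So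
  if \<open>T\<close> is bounded on \<open>U\<^sub>1\<close> and \<open>S\<close> on \<open>U\<^sub>2\<close>, then \<open>T + S\<close> is bounded on \<open>U\<^sub>1 \<inter> U\<^sub>2\<close>. For inverses,
  a cover of \<open>B\<close> by sums from \<open>- V\<close> is a cover of \<open>- B\<close> by sums from \<open>V\<close>.

  Convergence uses that commutativity turns the difference of two sums into the sum of the
  differences, \<open>(T\<^sub>\<alpha> + S\<^sub>\<alpha>) - (T + S) = (T\<^sub>\<alpha> - T) + (S\<^sub>\<alpha> - S)\<close>. If the two nets converge uniformly on
  \<open>U\<^sub>1\<close> and \<open>U\<^sub>2\<close>, the domain \<open>U\<^sub>1 \<inter> U\<^sub>2\<close> works for the sum: given \<open>V\<close>, continuity of addition yields
  \<open>W\<close> with \<open>W + W \<subseteq> V\<close>, and both summands lie in \<open>W\<close> beyond a common index. Similarly the difference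
  of the negated homomorphisms is \<open>- (T\<^sub>\<alpha> - T)\<close>, which lies in \<open>V\<close> once \<open>T\<^sub>\<alpha> - T\<close> lies in \<open>- V\<close>.
\<close>

lemma nbhd0_iff_eventually: "nbhd0 U \<longleftrightarrow> (\<forall>\<^sub>F x in nhds 0. x \<in> U)"
  unfolding nbhd0_def eventually_nhds by auto

lemma nbhd0_Int: "nbhd0 U \<Longrightarrow> nbhd0 V \<Longrightarrow> nbhd0 (U \<inter> V)"
  by (simp add: nbhd0_iff_eventually eventually_conj_iff)

lemma nbhd0_uminus_vimage:
  assumes "nbhd0 V"
  shows "nbhd0 (uminus -` V)"
proof -
  have "filterlim uminus (nhds (- 0)) (nhds (0::'a))"
    by (rule tendsto_minus) (simp add: filterlim_ident)
  then have "filterlim uminus (nhds 0) (nhds (0::'a))"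
    by simp
  from eventually_compose_filterlim[OF _ this] show ?thesis
    using assms by (simp add: nbhd0_iff_eventually)
qed

lemma nbhd0_split_sum:
  assumes "nbhd0 V"
  obtains W where "nbhd0 W" and "\<And>x y. x \<in> W \<Longrightarrow> y \<in> W \<Longrightarrow> x + y \<in> V"
proof -
  have "\<forall>\<^sub>F p in nhds (0::'a) \<times>\<^sub>F nhds 0. fst p + snd p \<in> V"
    using assms eventually_compose_filterlim[OF _ tendsto_add_Pair[of "0::'a" 0], of "\<lambda>x. x \<in> V"]
    by (simp add: nbhd0_iff_eventually)
  then obtain P where "eventually P (nhds 0)" and "\<And>x y. P x \<Longrightarrow> P y \<Longrightarrow> x + y \<in> V"
    by (auto simp: eventually_prod_same)
  then show thesis
    using that[of "Collect P"] by (simp add: nbhd0_iff_eventually)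
qed

lemma nfold_sum_add:
  assumes "x \<in> nfold_sum m V" and "y \<in> nfold_sum n V"
  shows "x + y \<in> nfold_sum (m + n) V"
proof -
  obtain u v where u: "x = (\<Sum>i<m. u i)" "\<forall>i<m. u i \<in> V"
    and v: "y = (\<Sum>i<n. v i)" "\<forall>i<n. v i \<in> V"
    using assms unfolding nfold_sum_def by blast
  define w where "w i = (if i < m then u i else v (i - m))" for i
  have "(\<Sum>i<m + n. w i) = (\<Sum>i<m. w i) + (\<Sum>i<n. w (m + i))"
    by (induction n) (simp_all add: add.assoc)
  then have "(\<Sum>i<m + n. w i) = x + y"
    unfolding u v by (simp add: w_def)
  moreover have "\<forall>i<m + n. w i \<in> V"
    using u v by (auto simp: w_def)
  ultimately show ?thesis
    unfolding nfold_sum_def by force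
qed

lemma nfold_sum_uminus:
  assumes "x \<in> nfold_sum n (uminus -` V)"
  shows "- x \<in> nfold_sum n V"
proof -
  obtain u where "x = (\<Sum>i<n. u i)" "\<forall>i<n. - u i \<in> V"
    using assms unfolding nfold_sum_def by auto
  then have "- x = (\<Sum>i<n. - u i)" "\<forall>i<n. - u i \<in> V"
    by (simp_all add: sum_negf)
  then show ?thesis
    unfolding nfold_sum_def by (intro CollectI exI[of _ "\<lambda>i. - u i"] conjI)
qed

text \<open>
  Boundedness on \<open>U\<^sub>1 \<inter> U\<^sub>2\<close> needs no shrinking of the target neighbourhood \<open>V\<close>: only the number of
  summands depends on \<open>V\<close>, and the numbers for \<open>T\<close> and \<open>S\<close> add up.
\<close>

lemma hom_mult_in_Hom_nb:
  assumes "T \<in> Hom_nb" and "S \<in> Hom_nb"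
  shows "hom_mult T S \<in> Hom_nb"
proof -
  obtain U1 U2 where add: "additive T" "additive S"
    and U: "nbhd0 U1" "nbhd0 U2" and bdd: "group_bounded (T ` U1)" "group_bounded (S ` U2)"
    using assms unfolding Hom_nb_def by blast
  have "group_bounded (hom_mult T S ` (U1 \<inter> U2))"
    unfolding group_bounded_def
  proof (intro allI impI)
    fix V :: "'a set"
    assume "nbhd0 V"
    then obtain m n where mn: "m > 0" "T ` U1 \<subseteq> nfold_sum m V" "S ` U2 \<subseteq> nfold_sum n V"
      using bdd unfolding group_bounded_def by blast
    then have "hom_mult T S ` (U1 \<inter> U2) \<subseteq> nfold_sum (m + n) V"
      unfolding hom_mult_def by (auto intro!: nfold_sum_add)
    with \<open>m > 0\<close> show "\<exists>k>0. hom_mult T S ` (U1 \<inter> U2) \<subseteq> nfold_sum k V"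
      by (intro exI[of _ "m + n"]) simp
  qed
  moreover have "additive (hom_mult T S)"
    using add by (simp add: additive_def hom_mult_def algebra_simps)
  ultimately show ?thesis
    using nbhd0_Int[OF U] unfolding Hom_nb_def by blast
qed

lemma hom_inv_in_Hom_nb:
  assumes "T \<in> Hom_nb"
  shows "hom_inv T \<in> Hom_nb"
proof -
  obtain U where add: "additive T" and U: "nbhd0 U" and bdd: "group_bounded (T ` U)"
    using assms unfolding Hom_nb_def by blast
  have "group_bounded (hom_inv T ` U)"
    unfolding group_bounded_def
  proof (intro allI impI)
    fix V :: "'a set"
    assume "nbhd0 V"
    then obtain n where "n > 0" "T ` U \<subseteq> nfold_sum n (uminus -` V)"
      using bdd nbhd0_uminus_vimage unfolding group_bounded_def by blast
    then show "\<exists>n>0. hom_inv T ` U \<subseteq> nfold_sum n V"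
      unfolding hom_inv_def by (intro exI[of _ n]) (auto intro!: nfold_sum_uminus)
  qed
  moreover have "additive (hom_inv T)"
    using add by (simp add: additive_def hom_inv_def)
  ultimately show ?thesis
    using U unfolding Hom_nb_def by blast
qed

text \<open>
  The domain \<open>U\<^sub>1 \<inter> U\<^sub>2\<close> of uniform convergence comes from the two nets alone, hence before \<open>V\<close> is
  given; the auxiliary \<open>W\<close> with \<open>W + W \<subseteq> V\<close> only influences the index.
\<close>

lemma nb_converges_hom_mult:
  fixes Tn Sn :: "'i \<Rightarrow> 'a::topological_ab_group_add \<Rightarrow> 'a"
  assumes dir: "directed_set D le"
    and T: "nb_converges D le Tn T" and S: "nb_converges D le Sn S"
  shows "nb_converges D le (\<lambda>\<alpha>. hom_mult (Tn \<alpha>) (Sn \<alpha>)) (hom_mult T S)"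
proof -
  obtain U1 where U1: "nbhd0 U1" and conv1: "\<And>V. nbhd0 V \<Longrightarrow>
      \<exists>\<alpha>0\<in>D. \<forall>\<alpha>\<in>D. le \<alpha>0 \<alpha> \<longrightarrow> (\<lambda>x. Tn \<alpha> x - T x) ` U1 \<subseteq> V"
    using T unfolding nb_converges_def by blast
  obtain U2 where U2: "nbhd0 U2" and conv2: "\<And>V. nbhd0 V \<Longrightarrow>
      \<exists>\<alpha>0\<in>D. \<forall>\<alpha>\<in>D. le \<alpha>0 \<alpha> \<longrightarrow> (\<lambda>x. Sn \<alpha> x - S x) ` U2 \<subseteq> V"
    using S unfolding nb_converges_def by blast
  have "\<exists>\<gamma>\<in>D. \<forall>\<alpha>\<in>D. le \<gamma> \<alpha> \<longrightarrow>
      (\<lambda>x. hom_mult (Tn \<alpha>) (Sn \<alpha>) x - hom_mult T S x) ` (U1 \<inter> U2) \<subseteq> V" if "nbhd0 V" for V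
  proof -
    obtain W where W: "nbhd0 W" and WV: "\<And>x y. x \<in> W \<Longrightarrow> y \<in> W \<Longrightarrow> x + y \<in> V"
      using nbhd0_split_sum[OF \<open>nbhd0 V\<close>] by blast
    obtain a where a: "a \<in> D" "\<And>\<alpha>. \<alpha> \<in> D \<Longrightarrow> le a \<alpha> \<Longrightarrow> (\<lambda>x. Tn \<alpha> x - T x) ` U1 \<subseteq> W"
      using conv1[OF W] by blast
    obtain b where b: "b \<in> D" "\<And>\<alpha>. \<alpha> \<in> D \<Longrightarrow> le b \<alpha> \<Longrightarrow> (\<lambda>x. Sn \<alpha> x - S x) ` U2 \<subseteq> W"
      using conv2[OF W] by blast
    obtain c where c: "c \<in> D" "le a c" "le b c"
      using dir a(1) b(1) unfolding directed_set_def by blast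
    have "(\<lambda>x. hom_mult (Tn \<alpha>) (Sn \<alpha>) x - hom_mult T S x) ` (U1 \<inter> U2) \<subseteq> V"
      if "\<alpha> \<in> D" "le c \<alpha>" for \<alpha>
    proof (rule image_subsetI)
      fix x
      assume x: "x \<in> U1 \<inter> U2"
      have "le a \<alpha>" "le b \<alpha>"
        using dir a(1) b(1) c that unfolding directed_set_def by (blast dest: transp_onD)+
      then have "Tn \<alpha> x - T x \<in> W" "Sn \<alpha> x - S x \<in> W"
        using a(2) b(2) \<open>\<alpha> \<in> D\<close> x by blast+
      then have "(Tn \<alpha> x - T x) + (Sn \<alpha> x - S x) \<in> V"
        by (rule WV)
      then show "hom_mult (Tn \<alpha>) (Sn \<alpha>) x - hom_mult T S x \<in> V"
        by (simp add: hom_mult_def algebra_simps)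
    qed
    with \<open>c \<in> D\<close> show ?thesis
      by blast
  qed
  moreover have "\<forall>\<alpha>\<in>D. hom_mult (Tn \<alpha>) (Sn \<alpha>) \<in> Hom_nb" "hom_mult T S \<in> Hom_nb"
    using T S by (auto simp: nb_converges_def intro!: hom_mult_in_Hom_nb)
  ultimately show ?thesis
    using nbhd0_Int[OF U1 U2] unfolding nb_converges_def by blast
qed

lemma nb_converges_hom_inv:
  fixes Tn :: "'i \<Rightarrow> 'a::topological_ab_group_add \<Rightarrow> 'a"
  assumes T: "nb_converges D le Tn T"
  shows "nb_converges D le (\<lambda>\<alpha>. hom_inv (Tn \<alpha>)) (hom_inv T)"
proof -
  obtain U where U: "nbhd0 U" and conv: "\<And>V. nbhd0 V \<Longrightarrow>
      \<exists>\<alpha>0\<in>D. \<forall>\<alpha>\<in>D. le \<alpha>0 \<alpha> \<longrightarrow> (\<lambda>x. Tn \<alpha> x - T x) ` U \<subseteq> V"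
    using T unfolding nb_converges_def by blast
  have "(\<lambda>x. hom_inv (Tn \<alpha>) x - hom_inv T x) ` U \<subseteq> V \<longleftrightarrow>
      (\<lambda>x. Tn \<alpha> x - T x) ` U \<subseteq> uminus -` V" for \<alpha> V
    by (simp add: hom_inv_def image_subset_iff)
  then have "\<exists>\<alpha>0\<in>D. \<forall>\<alpha>\<in>D. le \<alpha>0 \<alpha> \<longrightarrow>
      (\<lambda>x. hom_inv (Tn \<alpha>) x - hom_inv T x) ` U \<subseteq> V" if "nbhd0 V" for V
    using conv[OF nbhd0_uminus_vimage[OF that]] by simp
  moreover have "\<forall>\<alpha>\<in>D. hom_inv (Tn \<alpha>) \<in> Hom_nb" "hom_inv T \<in> Hom_nb"
    using T by (auto simp: nb_converges_def intro!: hom_inv_in_Hom_nb)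
  ultimately show ?thesis
    using U unfolding nb_converges_def by blast
qed

theorem theorem2p7:
  fixes D :: "'i set" and le :: "'i \<Rightarrow> 'i \<Rightarrow> bool"
    and Tn Sn :: "'i \<Rightarrow> 'a::topological_ab_group_add \<Rightarrow> 'a" and T S :: "'a \<Rightarrow> 'a"
  assumes "directed_set D le"
  shows "(nb_converges D le Tn T \<and> nb_converges D le Sn S \<longrightarrow>
            nb_converges D le (\<lambda>\<alpha>. hom_mult (Tn \<alpha>) (Sn \<alpha>)) (hom_mult T S)) \<and>
         (nb_converges D le Tn T \<longrightarrow>
            nb_converges D le (\<lambda>\<alpha>. hom_inv (Tn \<alpha>)) (hom_inv T))"
  using nb_converges_hom_mult[OF assms] nb_converges_hom_inv by blast

end
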